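(* Let $\phi$ be an $\mathsf{LTL}_f$ formula. Then $\phi$ is satisfiable if and only if there is a run $s_0\to s_1\to\cdots\to s_n$ ($n\ge 0$) of $T_\phi$ starting from the initial state $s_0=\{\phi\}$ such that (1) $s_n$ is a final state, and (2) for every $i$ with $0\le i\le n$ and every conflict sequence $\mathcal{C}$ of $T_\phi$ with $|\mathcal{C}|>n-i$, the state $s_i$ does not belong to $\mathcal{C}[n-i]$.
   Context: $\mathsf{LTL}_f$ is linear temporal logic interpreted over finite nonempty traces over a finite set $P$ of atoms; $\phi$ is satisfiable iff some finite nonempty trace satisfies it. $Tail$ denotes the formula that holds exactly at the last position of a trace. For a formula $\psi$, $\mathrm{xnf}(\psi)$ is its neXt normal form, an $\mathsf{LTL}_f$ formula equivalent to $\psi$ (possibly containing $Tail$) in which every temporal subformula occurs in the scope of a next operator $\mathsf{X}$; for a set $s$ of formulas, $\mathrm{xnf}(s)=\bigwedge_{\psi\in s}\mathrm{xnf}(\psi)$. For a formula $\theta$, $\theta^p$ is its propositional abstraction, obtained by treating each subformula of the form $\mathsf{X}\chi$ (and $Tail$) as a fresh Boolean variable. The transition system $T_\phi$ has as states finite sets of $\mathsf{LTL}_f$ formulas (each read as the conjunction of its elements), initial state $s_0=\{\phi\}$, and a transition $s\to s'$ whenever there is a satisfying assignment $A$ of $\mathrm{xnf}(s)^p$ with $s'=\{\chi : \text{the variable for } \mathsf{X}\chi \text{ is true in } A\}$; $s'$ is then a one-transition next state of $s$. A run is a sequence of states $s_0\to s_1\to\cdots\to s_n$ connected by transitions. A state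 $s$ is final iff $Tail\wedge \mathrm{xnf}(s)^p$ is satisfiable. It is a known property of $T_\phi$ that $\phi$ is satisfiable iff some run of $T_\phi$ from $s_0$ ends in a final state. A conflict sequence for $T_\phi$ is a finite nonempty sequence $\mathcal{C}[0],\ldots,\mathcal{C}[|\mathcal{C}|-1]$ of sets of states of $T_\phi$ such that: (1) $s_0\in\mathcal{C}[i]$ for all $0\le i<|\mathcal{C}|$; (2) no state in $\mathcal{C}[0]$ is final; (3) for every $0\le i<|\mathcal{C}|-1$ and every $s\in\mathcal{C}[i+1]$, all one-transition next states of $s$ belong to $\mathcal{C}[i]$. *)

theory Defs imports Main begin

datatype (atoms: 'a) ltlf =
    TT
  | FF
  | Atom 'a
  | Tail
  | Neg "'a ltlf"
  | Conj "'a ltlf" "'a ltlf"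
  | Disj "'a ltlf" "'a ltlf"
  | Next "'a ltlf"
  | WNext "'a ltlf"
  | Until "'a ltlf" "'a ltlf"
  | Release "'a ltlf" "'a ltlf"

text \<open>\<open>sat \<xi> i \<psi>\<close> is meant for positions \<open>i < length \<xi>\<close>. \<open>Next\<close> is the strong
  and \<open>WNext\<close> the weak next operator.\<close>

primrec sat :: "'a set list \<Rightarrow> nat \<Rightarrow> 'a ltlf \<Rightarrow> bool" where
  "sat \<xi> i TT \<longleftrightarrow> True"
| "sat \<xi> i FF \<longleftrightarrow> False"
| "sat \<xi> i (Atom p) \<longleftrightarrow> p \<in> \<xi> ! i"
| "sat \<xi> i Tail \<longleftrightarrow> Suc i = length \<xi>"
| "sat \<xi> i (Neg \<psi>) \<longleftrightarrow> \<not> sat \<xi> i \<psi>"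
| "sat \<xi> i (Conj \<psi>\<^sub>1 \<psi>\<^sub>2) \<longleftrightarrow> sat \<xi> i \<psi>\<^sub>1 \<and> sat \<xi> i \<psi>\<^sub>2"
| "sat \<xi> i (Disj \<psi>\<^sub>1 \<psi>\<^sub>2) \<longleftrightarrow> sat \<xi> i \<psi>\<^sub>1 \<or> sat \<xi> i \<psi>\<^sub>2"
| "sat \<xi> i (Next \<psi>) \<longleftrightarrow> Suc i < length \<xi> \<and> sat \<xi> (Suc i) \<psi>"
| "sat \<xi> i (WNext \<psi>) \<longleftrightarrow> (Suc i < length \<xi> \<longrightarrow> sat \<xi> (Suc i) \<psi>)"
| "sat \<xi> i (Until \<psi>\<^sub>1 \<psi>\<^sub>2) \<longleftrightarrow>
     (\<exists>k. i \<le> k \<and> k < length \<xi> \<and> sat \<xi> k \<psi>\<^sub>2 \<and> (\<forall>j. i \<le> j \<and> j < k \<longrightarrow> sat \<xi> j \<psi>\<^sub>1))"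
| "sat \<xi> i (Release \<psi>\<^sub>1 \<psi>\<^sub>2) \<longleftrightarrow>
     (\<forall>k. i \<le> k \<and> k < length \<xi> \<longrightarrow> sat \<xi> k \<psi>\<^sub>2 \<or> (\<exists>j. i \<le> j \<and> j < k \<and> sat \<xi> j \<psi>\<^sub>1))"

definition satisfiable :: "'a set \<Rightarrow> 'a ltlf \<Rightarrow> bool" where
  "satisfiable P \<phi> \<longleftrightarrow> (\<exists>\<xi>. \<xi> \<noteq> [] \<and> set \<xi> \<subseteq> Pow P \<and> sat \<xi> 0 \<phi>)"

text \<open>Negations are pushed inwards, so that every \<open>Next\<close> outside the scope of another
  \<open>Next\<close> occurs positively: a transition only records the \<open>Next\<close> variables that are
  true. Each such \<open>Next\<close> is moreover guarded by \<open>Tail\<close>, because the propositional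
  abstraction forgets that \<open>Next \<chi>\<close> is false at the last position: without the guard
  \<open>{Next \<chi>}\<close> would be a final state.\<close>

fun xnf :: "'a ltlf \<Rightarrow> 'a ltlf" where
  "xnf TT = TT"
| "xnf FF = FF"
| "xnf (Atom p) = Atom p"
| "xnf Tail = Tail"
| "xnf (Conj a b) = Conj (xnf a) (xnf b)"
| "xnf (Disj a b) = Disj (xnf a) (xnf b)"
| "xnf (Next a) = Conj (Neg Tail) (Next a)"
| "xnf (WNext a) = Disj Tail (Next a)"
| "xnf (Until a b) = Disj (xnf b) (Conj (xnf a) (Conj (Neg Tail) (Next (Until a b))))"
| "xnf (Release a b) = Conj (xnf b) (Disj (xnf a) (Disj Tail (Next (Release a b))))"
| "xnf (Neg TT) = FF"
| "xnf (Neg FF) = TT"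
| "xnf (Neg (Atom p)) = Neg (Atom p)"
| "xnf (Neg Tail) = Neg Tail"
| "xnf (Neg (Neg a)) = xnf a"
| "xnf (Neg (Conj a b)) = Disj (xnf (Neg a)) (xnf (Neg b))"
| "xnf (Neg (Disj a b)) = Conj (xnf (Neg a)) (xnf (Neg b))"
| "xnf (Neg (Next a)) = Disj Tail (Next (Neg a))"
| "xnf (Neg (WNext a)) = Conj (Neg Tail) (Next (Neg a))"
| "xnf (Neg (Until a b)) =
     Conj (xnf (Neg b)) (Disj (xnf (Neg a)) (Disj Tail (Next (Neg (Until a b)))))"
| "xnf (Neg (Release a b)) =
     Disj (xnf (Neg b)) (Conj (xnf (Neg a)) (Conj (Neg Tail) (Next (Neg (Release a b)))))"

primrec temporal_guarded :: "'a ltlf \<Rightarrow> bool" where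
  "temporal_guarded TT \<longleftrightarrow> True"
| "temporal_guarded FF \<longleftrightarrow> True"
| "temporal_guarded (Atom p) \<longleftrightarrow> True"
| "temporal_guarded Tail \<longleftrightarrow> True"
| "temporal_guarded (Neg a) \<longleftrightarrow> temporal_guarded a"
| "temporal_guarded (Conj a b) \<longleftrightarrow> temporal_guarded a \<and> temporal_guarded b"
| "temporal_guarded (Disj a b) \<longleftrightarrow> temporal_guarded a \<and> temporal_guarded b"
| "temporal_guarded (Next a) \<longleftrightarrow> True"
| "temporal_guarded (WNext a) \<longleftrightarrow> False"
| "temporal_guarded (Until a b) \<longleftrightarrow> False"
| "temporal_guarded (Release a b) \<longleftrightarrow> False"

lemma temporal_guarded_xnf: "temporal_guarded (xnf \<psi>)"
  by (induction \<psi> rule: xnf.induct) simp_all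

lemma sat_Until_unfold:
  assumes "i < length \<xi>"
  shows "sat \<xi> i (Until a b) \<longleftrightarrow>
    sat \<xi> i b \<or> (sat \<xi> i a \<and> Suc i < length \<xi> \<and> sat \<xi> (Suc i) (Until a b))"
proof
  assume "sat \<xi> i (Until a b)"
  then obtain k where k: "i \<le> k" "k < length \<xi>" "sat \<xi> k b"
      "\<forall>j. i \<le> j \<and> j < k \<longrightarrow> sat \<xi> j a"
    by auto
  show "sat \<xi> i b \<or> (sat \<xi> i a \<and> Suc i < length \<xi> \<and> sat \<xi> (Suc i) (Until a b))"
  proof (cases "k = i")
    case False
    with k have "Suc i \<le> k" by simp
    with k show ?thesis by auto
  qed (use k in simp)
next
  assume *: "sat \<xi> i b \<or> (sat \<xi> i a \<and> Suc i < length \<xi> \<and> sat \<xi> (Suc i) (Until a b))"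
  show "sat \<xi> i (Until a b)"
  proof (cases "sat \<xi> i b")
    case True
    with assms show ?thesis by auto
  next
    case False
    with * obtain k where k: "sat \<xi> i a" "Suc i \<le> k" "k < length \<xi>" "sat \<xi> k b"
        "\<forall>j. Suc i \<le> j \<and> j < k \<longrightarrow> sat \<xi> j a"
      by auto
    have "\<forall>j. i \<le> j \<and> j < k \<longrightarrow> sat \<xi> j a"
      using k by (metis Suc_leI le_neq_implies_less)
    with k have "\<exists>k. i \<le> k \<and> k < length \<xi> \<and> sat \<xi> k b \<and> (\<forall>j. i \<le> j \<and> j < k \<longrightarrow> sat \<xi> j a)"
      by (meson Suc_leD)
    then show ?thesis by simp
  qed
qed

lemma sat_Release_dual: "sat \<xi> i (Release a b) \<longleftrightarrow> \<not> sat \<xi> i (Until (Neg a) (Neg b))"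
  by auto

lemma sat_Release_unfold:
  assumes "i < length \<xi>"
  shows "sat \<xi> i (Release a b) \<longleftrightarrow>
    sat \<xi> i b \<and> (sat \<xi> i a \<or> \<not> Suc i < length \<xi> \<or> sat \<xi> (Suc i) (Release a b))"
  unfolding sat_Release_dual sat_Until_unfold[OF assms] by auto

lemma sat_xnf:
  assumes "i < length \<xi>"
  shows "sat \<xi> i (xnf \<psi>) \<longleftrightarrow> sat \<xi> i \<psi>"
proof -
  have tail: "Suc i = length \<xi> \<longleftrightarrow> \<not> Suc i < length \<xi>"
    using assms by auto
  show ?thesis
    by (induction \<psi> rule: xnf.induct)
      (simp_all only: xnf.simps sat.simps(1-9) tail sat_Until_unfold[OF assms]
        sat_Release_unfold[OF assms], blast+)
qed

definition big_conj :: "'a ltlf list \<Rightarrow> 'a ltlf" where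
  "big_conj \<psi>s = foldr Conj \<psi>s TT"

text \<open>The conjunction over a state needs some enumeration of its elements; which one is
  immaterial.\<close>

definition xnf_state :: "'a ltlf set \<Rightarrow> 'a ltlf" where
  "xnf_state s = big_conj (map xnf (SOME \<psi>s. set \<psi>s = s \<and> distinct \<psi>s))"

datatype (pvars: 'v) pform =
    PTrue
  | PFalse
  | PVar 'v
  | PNot "'v pform"
  | PAnd "'v pform" "'v pform"
  | POr "'v pform" "'v pform"

text \<open>A propositional assignment is given by the set of variables that it makes true.\<close>

primrec psat :: "'v set \<Rightarrow> 'v pform \<Rightarrow> bool" where
  "psat A PTrue \<longleftrightarrow> True"
| "psat A PFalse \<longleftrightarrow> False"
| "psat A (PVar v) \<longleftrightarrow> v \<in> A"
| "psat A (PNot F) \<longleftrightarrow> \<not> psat A F"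
| "psat A (PAnd F G) \<longleftrightarrow> psat A F \<and> psat A G"
| "psat A (POr F G) \<longleftrightarrow> psat A F \<or> psat A G"

definition satisfying_assignment :: "'v set \<Rightarrow> 'v pform \<Rightarrow> bool" where
  "satisfying_assignment A F \<longleftrightarrow> A \<subseteq> pvars F \<and> psat A F"

definition psatisfiable :: "'v pform \<Rightarrow> bool" where
  "psatisfiable F \<longleftrightarrow> (\<exists>A. satisfying_assignment A F)"

text \<open>The Boolean variables are named by the formulas they abstract. The last three
  equations only make the function total: by \<open>temporal_guarded_xnf\<close> they are never
  reached on a neXt normal form.\<close>

primrec pabs :: "'a ltlf \<Rightarrow> 'a ltlf pform" where
  "pabs TT = PTrue"
| "pabs FF = PFalse"
| "pabs (Atom p) = PVar (Atom p)"
| "pabs Tail = PVar Tail"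
| "pabs (Neg \<psi>) = PNot (pabs \<psi>)"
| "pabs (Conj \<psi>\<^sub>1 \<psi>\<^sub>2) = PAnd (pabs \<psi>\<^sub>1) (pabs \<psi>\<^sub>2)"
| "pabs (Disj \<psi>\<^sub>1 \<psi>\<^sub>2) = POr (pabs \<psi>\<^sub>1) (pabs \<psi>\<^sub>2)"
| "pabs (Next \<psi>) = PVar (Next \<psi>)"
| "pabs (WNext \<psi>) = PVar (WNext \<psi>)"
| "pabs (Until \<psi>\<^sub>1 \<psi>\<^sub>2) = PVar (Until \<psi>\<^sub>1 \<psi>\<^sub>2)"
| "pabs (Release \<psi>\<^sub>1 \<psi>\<^sub>2) = PVar (Release \<psi>\<^sub>1 \<psi>\<^sub>2)"

definition ts_states :: "'a set \<Rightarrow> 'a ltlf set set" where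
  "ts_states P = {s. finite s \<and> (\<forall>\<psi>\<in>s. atoms \<psi> \<subseteq> P)}"

definition ts_init :: "'a ltlf \<Rightarrow> 'a ltlf set" where
  "ts_init \<phi> = {\<phi>}"

definition ts_step :: "'a ltlf set \<Rightarrow> 'a ltlf set \<Rightarrow> bool" where
  "ts_step s s' \<longleftrightarrow>
     (\<exists>A. satisfying_assignment A (pabs (xnf_state s)) \<and> s' = {\<chi>. Next \<chi> \<in> A})"

definition final :: "'a ltlf set \<Rightarrow> bool" where
  "final s \<longleftrightarrow> psatisfiable (PAnd (pabs Tail) (pabs (xnf_state s)))"

text \<open>The run \<open>s 0, \<dots>, s n\<close>; the values of \<open>s\<close> beyond \<open>n\<close> are irrelevant.\<close>

definition run_from_init ::
    "'a set \<Rightarrow> 'a ltlf \<Rightarrow> nat \<Rightarrow> (nat \<Rightarrow> 'a ltlf set) \<Rightarrow> bool" where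
  "run_from_init P \<phi> n s \<longleftrightarrow>
     s 0 = ts_init \<phi> \<and> (\<forall>i\<le>n. s i \<in> ts_states P) \<and> (\<forall>i<n. ts_step (s i) (s (Suc i)))"

definition conflict_sequence :: "'a set \<Rightarrow> 'a ltlf \<Rightarrow> 'a ltlf set set list \<Rightarrow> bool" where
  "conflict_sequence P \<phi> C \<longleftrightarrow>
     C \<noteq> [] \<and>
     (\<forall>i<length C. C ! i \<subseteq> ts_states P) \<and>
     (\<forall>i<length C. ts_init \<phi> \<in> C ! i) \<and>
     (\<forall>s\<in>C ! 0. \<not> final s) \<and>
     (\<forall>i. i < length C - 1 \<longrightarrow> (\<forall>s\<in>C ! (i + 1). \<forall>s'. ts_step s s' \<longrightarrow> s' \<in> C ! i))"

end

(* Avoiding every conflict sequence costs nothing: if s_i lies in C[n-i], then following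
   the run pushes s_(i+1), ..., s_n through C[n-i-1], ..., C[0], and C[0] contains no final
   state. What remains is that the accepting runs of the transition system are the models
   of phi. A trace yields a run by letting the assignment at each position be the set of
   formulas true there. Conversely a trace is assembled backwards from a run to a final
   state; a transition whose assignment makes Tail true need not reflect a step in a trace,
   but then its source is itself final and the trace may end there. *)

theory Submission imports Defs begin

text \<open>Truth depends only on the variables that occur, so any assignment may be cut down to the
  form \<open>satisfying_assignment\<close> demands.\<close>

lemma psat_Int_pvars: "pvars F \<subseteq> B \<Longrightarrow> psat (A \<inter> B) F \<longleftrightarrow> psat A F"
  by (induction F) auto

lemma finite_pvars: "finite (pvars F)"
  by (induction F) auto

lemma psatisfiable_iff: "psatisfiable F \<longleftrightarrow> (\<exists>A. psat A F)"
  unfolding psatisfiable_def satisfying_assignment_def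
  by (metis inf_le2 order_refl psat_Int_pvars)

lemma set_some_enumeration:
  assumes "finite s"
  shows "set (SOME \<psi>s. set \<psi>s = s \<and> distinct \<psi>s) = s"
  using someI_ex[OF finite_distinct_list[OF assms]] by blast

lemma psat_big_conj: "psat A (pabs (big_conj \<psi>s)) \<longleftrightarrow> (\<forall>\<psi>\<in>set \<psi>s. psat A (pabs \<psi>))"
  unfolding big_conj_def by (induction \<psi>s) auto

lemma pvars_big_conj: "pvars (pabs (big_conj \<psi>s)) = (\<Union>\<psi>\<in>set \<psi>s. pvars (pabs \<psi>))"
  unfolding big_conj_def by (induction \<psi>s) auto

lemma psat_xnf_state:
  "finite s \<Longrightarrow> psat A (pabs (xnf_state s)) \<longleftrightarrow> (\<forall>\<psi>\<in>s. psat A (pabs (xnf \<psi>)))"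
  by (simp add: xnf_state_def psat_big_conj set_some_enumeration)

lemma pvars_xnf_state:
  "finite s \<Longrightarrow> pvars (pabs (xnf_state s)) = (\<Union>\<psi>\<in>s. pvars (pabs (xnf \<psi>)))"
  by (simp add: xnf_state_def pvars_big_conj set_some_enumeration)

lemma final_iff:
  "finite s \<Longrightarrow> final s \<longleftrightarrow> (\<exists>A. Tail \<in> A \<and> (\<forall>\<psi>\<in>s. psat A (pabs (xnf \<psi>))))"
  by (simp add: final_def psatisfiable_iff psat_xnf_state)

lemma atoms_pvars_pabs: "v \<in> pvars (pabs \<psi>) \<Longrightarrow> atoms v \<subseteq> atoms \<psi>"
  by (induction \<psi>) auto

lemma atoms_xnf: "atoms (xnf \<psi>) \<subseteq> atoms \<psi>"
  by (induction \<psi> rule: xnf.induct) auto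

lemma atoms_pvars_xnf_state:
  assumes "s \<in> ts_states P" and "v \<in> pvars (pabs (xnf_state s))"
  shows "atoms v \<subseteq> P"
proof -
  obtain \<psi> where \<psi>: "\<psi> \<in> s" "v \<in> pvars (pabs (xnf \<psi>))"
    using assms by (auto simp: ts_states_def pvars_xnf_state)
  have "atoms v \<subseteq> atoms (xnf \<psi>)"
    using atoms_pvars_pabs[OF \<psi>(2)] .
  also have "\<dots> \<subseteq> atoms \<psi>"
    by (rule atoms_xnf)
  also have "\<dots> \<subseteq> P"
    using assms(1) \<psi>(1) by (simp add: ts_states_def)
  finally show ?thesis .
qed

text \<open>The successor is finite because assignments contain only variables of the formula, and
  it stays over \<open>P\<close> because \<open>xnf\<close> introduces no new atoms.\<close>

lemma ts_step_states:
  assumes "ts_step s s'" and "s \<in> ts_states P"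
  shows "s' \<in> ts_states P"
proof -
  obtain A where A: "A \<subseteq> pvars (pabs (xnf_state s))" "s' = {\<chi>. Next \<chi> \<in> A}"
    using assms(1) unfolding ts_step_def satisfying_assignment_def by auto
  have "finite (Next -` A)"
    using A(1) by (intro finite_vimageI) (auto intro: finite_subset finite_pvars injI)
  moreover have "atoms \<chi> \<subseteq> P" if "\<chi> \<in> s'" for \<chi>
    using that A atoms_pvars_xnf_state[OF assms(2), of "Next \<chi>"] by auto
  ultimately show ?thesis
    using A(2) by (simp add: ts_states_def vimage_def)
qed

text \<open>Index shift for the quantifiers in the semantics of \<open>Until\<close> and
  \<open>Release\<close>, needed when a letter is prepended to a trace.\<close>

lemma ex_Suc_le_iff: "(\<exists>k. Suc i \<le> k \<and> Q k) \<longleftrightarrow> (\<exists>k. i \<le> k \<and> Q (Suc k))"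
  using Suc_le_D by fastforce

lemma all_Suc_le_iff:
  "(\<forall>k. Suc i \<le> k \<and> Q k \<longrightarrow> R k) \<longleftrightarrow> (\<forall>k. i \<le> k \<and> Q (Suc k) \<longrightarrow> R (Suc k))"
  using ex_Suc_le_iff[of i "\<lambda>k. Q k \<and> \<not> R k"] by blast

lemma sat_Cons_Suc: "sat (a # \<xi>) (Suc i) \<psi> \<longleftrightarrow> sat \<xi> i \<psi>"
proof (induction \<psi> arbitrary: i)
  case (Until \<psi>\<^sub>1 \<psi>\<^sub>2)
  show ?case
    by (simp only: sat.simps ex_Suc_le_iff all_Suc_le_iff Until.IH length_Cons Suc_less_eq)
next
  case (Release \<psi>\<^sub>1 \<psi>\<^sub>2)
  show ?case
    by (simp only: sat.simps ex_Suc_le_iff all_Suc_le_iff Release.IH length_Cons Suc_less_eq)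
qed auto

lemma psat_pabs_sat: "psat {v. sat \<xi> i v} (pabs \<psi>) \<longleftrightarrow> sat \<xi> i \<psi>"
  by (induction \<psi>) auto

text \<open>The induction runs over the neXt normal form of \<open>\<psi>\<close> because there every \<open>Next\<close>
  outside the scope of another one is positive, so that only the truth of the
  \<open>Next\<close> variables matters.\<close>

lemma sat_Cons_if_psat_xnf:
  assumes "psat A (pabs (xnf \<psi>))"
    and "Tail \<in> A \<longleftrightarrow> \<xi> = []"
    and "\<And>\<chi>. Tail \<notin> A \<Longrightarrow> Next \<chi> \<in> A \<Longrightarrow> sat \<xi> 0 \<chi>"
  shows "sat ({p. Atom p \<in> A} # \<xi>) 0 \<psi>"
proof -
  have "sat ({p. Atom p \<in> A} # \<xi>) 0 (xnf \<psi>)"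
  proof (cases "\<xi> = []")
    \<comment> \<open>At the last position the \<open>Tail\<close> guards settle every subformula
      containing a \<open>Next\<close>, so the \<open>Next\<close> variables in \<open>A\<close> may
      have any value.\<close>
    case True
    with assms(1,2) show ?thesis
      by (induction \<psi> rule: xnf.induct) auto
  next
    case False
    with assms(2) have "Tail \<notin> A"
      by simp
    then have "sat \<xi> 0 \<chi>" if "Next \<chi> \<in> A" for \<chi>
      using that assms(3) by blast
    moreover from this[of "Neg \<chi>" for \<chi>] have "\<not> sat \<xi> 0 \<chi>" if "Next (Neg \<chi>) \<in> A" for \<chi>
      using that by simp
    ultimately show ?thesis
      using assms(1) \<open>\<xi> \<noteq> []\<close> \<open>Tail \<notin> A\<close>
      \<comment> \<open>\<open>Until\<close> and \<open>Release\<close> stay folded, so that the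
        formula below a \<open>Next\<close> variable matches the facts about \<open>A\<close> as a
        whole.\<close>
      by (induction \<psi> rule: xnf.induct) (auto simp: sat_Cons_Suc simp del: sat.simps(10,11))
  qed
  then show ?thesis
    by (simp add: sat_xnf)
qed

text \<open>The assignment obtained from \<open>final_iff\<close> is arbitrary, so the letters read
  off from it may contain atoms outside \<open>P\<close>; \<open>satisfiable P\<close> requires them
  to be removed.\<close>

lemma sat_trace_restrict:
  "atoms \<psi> \<subseteq> P \<Longrightarrow> i < length \<xi> \<Longrightarrow> sat (map (\<lambda>a. a \<inter> P) \<xi>) i \<psi> \<longleftrightarrow> sat \<xi> i \<psi>"
  by (induction \<psi> arbitrary: i) auto

lemma final_imp_sat:
  assumes "finite s" and "final s"
  shows "\<exists>\<xi>. \<xi> \<noteq> [] \<and> (\<forall>\<psi>\<in>s. sat \<xi> 0 \<psi>)"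
proof -
  obtain A where "Tail \<in> A" "\<forall>\<psi>\<in>s. psat A (pabs (xnf \<psi>))"
    using assms by (auto simp: final_iff)
  then have "\<forall>\<psi>\<in>s. sat [{p. Atom p \<in> A}] 0 \<psi>"
    by (auto intro: sat_Cons_if_psat_xnf)
  then show ?thesis
    by blast
qed

lemma ts_step_imp_sat:
  assumes "finite s" and "ts_step s s'" and "\<xi> \<noteq> []" and "\<forall>\<chi>\<in>s'. sat \<xi> 0 \<chi>"
  shows "\<exists>\<xi>. \<xi> \<noteq> [] \<and> (\<forall>\<psi>\<in>s. sat \<xi> 0 \<psi>)"
proof -
  obtain A where A: "\<forall>\<psi>\<in>s. psat A (pabs (xnf \<psi>))" "s' = {\<chi>. Next \<chi> \<in> A}"
    using assms(1,2) unfolding ts_step_def satisfying_assignment_def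
    by (auto simp: psat_xnf_state)
  show ?thesis
  proof (cases "Tail \<in> A")
    case True
    with A(1) assms(1) have "final s"
      by (auto simp: final_iff)
    with assms(1) show ?thesis
      by (rule final_imp_sat)
  next
    case False
    with A assms(3,4) have "\<forall>\<psi>\<in>s. sat ({p. Atom p \<in> A} # \<xi>) 0 \<psi>"
      by (auto intro: sat_Cons_if_psat_xnf)
    then show ?thesis
      by blast
  qed
qed

lemma accepting_run_imp_satisfiable:
  assumes "run_from_init P \<phi> n s" and "final (s n)"
  shows "satisfiable P \<phi>"
proof -
  have fin: "finite (s i)" if "i \<le> n" for i
    using assms(1) that by (simp add: run_from_init_def ts_states_def)
  have "\<exists>\<xi>. \<xi> \<noteq> [] \<and> (\<forall>\<psi>\<in>s i. sat \<xi> 0 \<psi>)" if "i \<le> n" for i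
    using that
  \<comment> \<open>Downward induction from \<open>n\<close>: the trace grows at its front.\<close>
  proof (induction rule: inc_induct)
    case base
    show ?case
      using final_imp_sat[OF fin[OF order_refl] assms(2)] .
  next
    case (step i)
    then obtain \<xi> where "\<xi> \<noteq> []" "\<forall>\<chi>\<in>s (Suc i). sat \<xi> 0 \<chi>"
      by blast
    moreover have "ts_step (s i) (s (Suc i))"
      using assms(1) step by (simp add: run_from_init_def)
    ultimately show ?case
      using ts_step_imp_sat fin step by (meson less_imp_le)
  qed
  from this[OF le0] obtain \<xi> where \<xi>: "\<xi> \<noteq> []" "sat \<xi> 0 \<phi>"
    using assms(1) by (auto simp: run_from_init_def ts_init_def)
  \<comment> \<open>This comes from the run itself: \<open>s 0\<close> is the singleton of
    \<open>\<phi>\<close> and a state over \<open>P\<close>.\<close>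
  have "atoms \<phi> \<subseteq> P"
    using assms(1) by (force simp: run_from_init_def ts_init_def ts_states_def)
  with \<xi> have "sat (map (\<lambda>a. a \<inter> P) \<xi>) 0 \<phi>"
    by (simp add: sat_trace_restrict)
  with \<xi>(1) show ?thesis
    unfolding satisfiable_def by (intro exI[of _ "map (\<lambda>a. a \<inter> P) \<xi>"]) auto
qed

lemma sat_imp_accepting_run:
  assumes "\<xi> \<noteq> []" and "s \<in> ts_states P" and "\<forall>\<psi>\<in>s. sat \<xi> 0 \<psi>"
  shows "\<exists>n f. f 0 = s \<and> (\<forall>i\<le>n. f i \<in> ts_states P) \<and> (\<forall>i<n. ts_step (f i) (f (Suc i))) \<and>
    final (f n)"
  using assms
proof (induction \<xi> arbitrary: s)
  case (Cons a \<xi>)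
  define A where "A = {v. sat (a # \<xi>) 0 v}"
  have A: "psat A (pabs (xnf \<psi>))" if "\<psi> \<in> s" for \<psi>
    using Cons.prems that unfolding A_def by (simp add: psat_pabs_sat sat_xnf)
  have fin: "finite s"
    using Cons.prems by (simp add: ts_states_def)
  show ?case
  proof (cases "\<xi> = []")
    case True
    then have "Tail \<in> A"
      by (simp add: A_def)
    with A fin have "final s"
      by (auto simp: final_iff)
    with Cons.prems show ?thesis
      by (intro exI[of _ 0] exI[of _ "\<lambda>_. s"]) auto
  next
    case False
    let ?V = "pvars (pabs (xnf_state s))"
    \<comment> \<open>\<open>A\<close> contains every formula true at the first position; only the
      \<open>Next\<close> formulas that occur in the abstraction become obligations of the
      successor.\<close>
    define s' where "s' = {\<chi>. Next \<chi> \<in> A \<inter> ?V}"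
    have "psat A (pabs (xnf_state s))"
      using A fin by (simp add: psat_xnf_state)
    then have "satisfying_assignment (A \<inter> ?V) (pabs (xnf_state s))"
      by (simp add: satisfying_assignment_def psat_Int_pvars)
    then have step: "ts_step s s'"
      unfolding ts_step_def s'_def by blast
    have "\<forall>\<chi>\<in>s'. sat \<xi> 0 \<chi>"
      by (auto simp: s'_def A_def sat_Cons_Suc)
    then obtain n f where f: "f 0 = s'" "\<forall>i\<le>n. f i \<in> ts_states P"
        "\<forall>i<n. ts_step (f i) (f (Suc i))" "final (f n)"
      using Cons.IH[OF False ts_step_states[OF step Cons.prems(2)]] by blast
    then show ?thesis
      using step Cons.prems(2)
      by (intro exI[of _ "Suc n"] exI[of _ "case_nat s f"]) (auto split: nat.splits)
  qed
qed simp

lemma conflict_sequence_final_notin: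
  assumes "conflict_sequence P \<phi> C" and "\<forall>j<n. ts_step (s j) (s (Suc j))" and "final (s n)"
    and "i \<le> n" and "n - i < length C"
  shows "s i \<notin> C ! (n - i)"
  using assms(4,5)
proof (induction rule: inc_induct)
  case base
  then show ?case
    using assms(1,3) by (auto simp: conflict_sequence_def)
next
  case (step m)
  \<comment> \<open>Written as a successor, the index \<open>n - m\<close> fits the condition that
    relates \<open>C ! (i + 1)\<close> to \<open>C ! i\<close>.\<close>
  then have nm: "n - m = n - Suc m + 1" and len: "n - Suc m < length C - 1"
    by simp_all
  have "s (Suc m) \<in> C ! (n - Suc m)" if "s m \<in> C ! (n - m)"
    using assms(1,2) that len \<open>m < n\<close> unfolding nm conflict_sequence_def by blast
  with step show ?case
    by auto
qed

theorem mainTheorem2: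
  fixes P :: "'a set" and \<phi> :: "'a ltlf"
  assumes "finite P" and "atoms \<phi> \<subseteq> P"
  shows "satisfiable P \<phi> \<longleftrightarrow>
    (\<exists>n s. run_from_init P \<phi> n s \<and> final (s n) \<and>
       (\<forall>i C. i \<le> n \<and> conflict_sequence P \<phi> C \<and> length C > n - i \<longrightarrow> s i \<notin> C ! (n - i)))"
proof
  assume "satisfiable P \<phi>"
  then obtain \<xi> where "\<xi> \<noteq> []" "sat \<xi> 0 \<phi>"
    by (auto simp: satisfiable_def)
  moreover have "ts_init \<phi> \<in> ts_states P"
    using assms(2) by (simp add: ts_init_def ts_states_def)
  ultimately obtain n s where "run_from_init P \<phi> n s" "final (s n)"
    using sat_imp_accepting_run[of \<xi> "ts_init \<phi>" P]
    unfolding run_from_init_def ts_init_def by auto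
  then show "\<exists>n s. run_from_init P \<phi> n s \<and> final (s n) \<and>
      (\<forall>i C. i \<le> n \<and> conflict_sequence P \<phi> C \<and> length C > n - i \<longrightarrow> s i \<notin> C ! (n - i))"
    by (intro exI[of _ n] exI[of _ s])
      (auto simp: run_from_init_def dest: conflict_sequence_final_notin)
qed (auto intro: accepting_run_imp_satisfiable)

end
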